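(* Let $X$ and $Y$ be linear spaces over a field $\mathbb{K}$ and let $f_{1,1}, f_{1,2}, f_{2,1}, f_{2,2}\colon X\times Y\to \mathbb{K}$ be functions with $f_{i,j}(0,0)=0$ for $i,j=1,2$. Then \[ f_{1,1}(x_{1},y_{1})+f_{1,2}(x_{1},y_{2})+f_{2,1}(x_{2},y_{1})+f_{2,2}(x_{2},y_{2})=0 \qquad (x_{1}, x_{2}\in X,\ y_{1}, y_{2}\in Y) \] holds if and only if for all $i,j\in\{1,2\}$ there exist functions $\chi_{i,j}\colon X\to \mathbb{K}$ and $\zeta_{i,j}\colon Y\to \mathbb{K}$ vanishing at $0$ such that \[ f_{i,j}(x,z)=\chi_{i,j}(x)+\zeta_{i,j}(z) \qquad (x\in X,\ z\in Y,\ i,j=1,2) \] and \[ \chi_{1,2}(x)+\chi_{1,1}(x)=0,\quad \chi_{2,2}(x)+\chi_{2,1}(x)=0,\quad \zeta_{2,1}(z)+\zeta_{1,1}(z)=0,\quad \zeta_{2,2}(z)+\zeta_{1,2}(z)=0 \qquad (x\in X,\ z\in Y). \] *)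

theory Defs
  imports Complex_Main
begin

end

theory Submission imports Defs begin

text \<open>
  The equation is an identity in four independent variables, so each of them may be set to \<open>0\<close>
  separately. Keeping only \<open>x\<^sub>1\<close> and \<open>y\<^sub>1\<close>, the last function drops out and the first one is minus a
  function of \<open>x\<^sub>1\<close> alone minus a function of \<open>y\<^sub>1\<close> alone; keeping a single variable identifies these
  two functions with the sections through the origin. Hence \<open>\<chi> i j x = f i j (x, 0)\<close> and
  \<open>\<zeta> i j z = f i j (0, z)\<close> are the only possible choice, and they work. The equation is invariant under
  swapping the two rows or the two columns of indices, so \<open>split_along_axes\<close>, which treats the corner
  \<open>a = f 1 1\<close>, yields the claims about every corner. Conversely, substituting the decompositions makes
  the sections cancel in pairs.
\<close>

lemma split_along_axes:
  fixes a b c d :: "'x::zero \<times> 'y::zero \<Rightarrow> 'k::ab_group_add"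
  assumes eq: "\<And>x x' y y'. a (x, y) + b (x, y') + c (x', y) + d (x', y') = 0"
    and "a (0, 0) = 0" "b (0, 0) = 0" "c (0, 0) = 0" "d (0, 0) = 0"
  shows "a (x, z) = a (x, 0) + a (0, z)"
    and "b (x, 0) + a (x, 0) = 0"
    and "c (0, z) + a (0, z) = 0"
proof -
  show row: "b (x, 0) + a (x, 0) = 0"
    using eq[of x 0 0 0] assms(2-) by (simp add: add.commute)
  show col: "c (0, z) + a (0, z) = 0"
    using eq[of 0 z 0 0] assms(2-) by (simp add: add.commute)
  have "a (x, z) + b (x, 0) + c (0, z) = 0"
    using eq[of x z 0 0] assms(2-) by simp
  moreover have "b (x, 0) = - a (x, 0)" "c (0, z) = - a (0, z)"
    using row col by (simp_all add: eq_neg_iff_add_eq_0)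
  ultimately show "a (x, z) = a (x, 0) + a (0, z)"
    by (simp add: algebra_simps)
qed

theorem proposition2:
  fixes scaleX :: "'k::field \<Rightarrow> 'x::ab_group_add \<Rightarrow> 'x"
    and scaleY :: "'k \<Rightarrow> 'y::ab_group_add \<Rightarrow> 'y"
    and f :: "nat \<Rightarrow> nat \<Rightarrow> 'x \<times> 'y \<Rightarrow> 'k"
  assumes "vector_space scaleX" and "vector_space scaleY"
    and "\<forall>i\<in>{1,2}. \<forall>j\<in>{1,2}. f i j (0, 0) = 0"
  shows "(\<forall>x\<^sub>1 x\<^sub>2 y\<^sub>1 y\<^sub>2.
            f 1 1 (x\<^sub>1, y\<^sub>1) + f 1 2 (x\<^sub>1, y\<^sub>2) + f 2 1 (x\<^sub>2, y\<^sub>1) + f 2 2 (x\<^sub>2, y\<^sub>2) = 0)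
     \<longleftrightarrow>
         (\<exists>(\<chi> :: nat \<Rightarrow> nat \<Rightarrow> 'x \<Rightarrow> 'k) (\<zeta> :: nat \<Rightarrow> nat \<Rightarrow> 'y \<Rightarrow> 'k).
            (\<forall>i\<in>{1,2}. \<forall>j\<in>{1,2}. \<chi> i j 0 = 0 \<and> \<zeta> i j 0 = 0) \<and>
            (\<forall>i\<in>{1,2}. \<forall>j\<in>{1,2}. \<forall>x z. f i j (x, z) = \<chi> i j x + \<zeta> i j z) \<and>
            (\<forall>x. \<chi> 1 2 x + \<chi> 1 1 x = 0) \<and>
            (\<forall>x. \<chi> 2 2 x + \<chi> 2 1 x = 0) \<and>
            (\<forall>z. \<zeta> 2 1 z + \<zeta> 1 1 z = 0) \<and>
            (\<forall>z. \<zeta> 2 2 z + \<zeta> 1 2 z = 0))"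
    (is "?eq \<longleftrightarrow> ?split")
proof
  assume eq: ?eq
  have zero: "f 1 1 (0, 0) = 0" "f 1 2 (0, 0) = 0" "f 2 1 (0, 0) = 0" "f 2 2 (0, 0) = 0"
    using assms(3) by auto
  have perm:
    "f 1 1 (x, y) + f 1 2 (x, y') + f 2 1 (x', y) + f 2 2 (x', y') = 0"
    "f 1 2 (x, y) + f 1 1 (x, y') + f 2 2 (x', y) + f 2 1 (x', y') = 0"
    "f 2 1 (x, y) + f 2 2 (x, y') + f 1 1 (x', y) + f 1 2 (x', y') = 0"
    "f 2 2 (x, y) + f 2 1 (x, y') + f 1 2 (x', y) + f 1 1 (x', y') = 0" for x x' y y'
    using eq by (simp_all only: ac_simps)
  note c11 = split_along_axes[of "f 1 1" "f 1 2" "f 2 1" "f 2 2", OF perm(1) zero(1,2,3,4)]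
   and c12 = split_along_axes[of "f 1 2" "f 1 1" "f 2 2" "f 2 1", OF perm(2) zero(2,1,4,3)]
   and c21 = split_along_axes[of "f 2 1" "f 2 2" "f 1 1" "f 1 2", OF perm(3) zero(3,4,1,2)]
   and c22 = split_along_axes[of "f 2 2" "f 2 1" "f 1 2" "f 1 1", OF perm(4) zero(4,3,2,1)]
  have split: "f i j (x, z) = f i j (x, 0) + f i j (0, z)"
    if "i \<in> {1, 2}" "j \<in> {1, 2}" for i j x z
    using that c11(1) c12(1) c21(1) c22(1) by blast
  show ?split
    by (intro exI[of _ "\<lambda>i j x. f i j (x, 0)"] exI[of _ "\<lambda>i j z. f i j (0, z)"] conjI ballI allI
        split c11(2) c21(2) c11(3) c12(3)) (use assms(3) in blast)+
next
  assume ?split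
  then obtain \<chi> \<zeta>
    where f: "\<forall>i\<in>{1,2}. \<forall>j\<in>{1,2}. \<forall>x z. f i j (x, z) = \<chi> i j x + \<zeta> i j z"
      and rows: "\<forall>x. \<chi> 1 2 x + \<chi> 1 1 x = 0" "\<forall>x. \<chi> 2 2 x + \<chi> 2 1 x = 0"
      and cols: "\<forall>z. \<zeta> 2 1 z + \<zeta> 1 1 z = 0" "\<forall>z. \<zeta> 2 2 z + \<zeta> 1 2 z = 0"
    by blast
  show ?eq
  proof (intro allI)
    fix x\<^sub>1 x\<^sub>2 y\<^sub>1 y\<^sub>2
    have "f 1 1 (x\<^sub>1, y\<^sub>1) + f 1 2 (x\<^sub>1, y\<^sub>2) + f 2 1 (x\<^sub>2, y\<^sub>1) + f 2 2 (x\<^sub>2, y\<^sub>2)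
        = (\<chi> 1 2 x\<^sub>1 + \<chi> 1 1 x\<^sub>1) + (\<chi> 2 2 x\<^sub>2 + \<chi> 2 1 x\<^sub>2)
        + (\<zeta> 2 1 y\<^sub>1 + \<zeta> 1 1 y\<^sub>1) + (\<zeta> 2 2 y\<^sub>2 + \<zeta> 1 2 y\<^sub>2)"
      using f by (simp add: ac_simps)
    also have "\<dots> = 0"
      using rows cols by (simp only: add_0)
    finally show "f 1 1 (x\<^sub>1, y\<^sub>1) + f 1 2 (x\<^sub>1, y\<^sub>2) + f 2 1 (x\<^sub>2, y\<^sub>1) + f 2 2 (x\<^sub>2, y\<^sub>2) = 0" .
  qed
qed

end
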